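(* Consider a single TTL cache and one object, with i.i.d. renewal inter-request times having the law of $X$ with CDF $F_X$, i.i.d. TTLs having the law of $T$ with CDF $F_T$, and object fetch delay $\Delta$ with CDF $F_\Delta$, under the assumption that, given a miss, there is a request arrival exactly at the instant the object is admitted to the cache (the end of the fetch delay). Let $L(t)=\int_0^t (1-F_T(x))\,dF_X(x)$, and let $F_X^*(s)$, $F_\Delta^*(s)$, $L^*(s)$ denote the Laplace-Stieltjes transforms of $F_X$, $F_\Delta$ and $L$. Then the Laplace-Stieltjes transform of the inter-miss time $Y$ is, for $s>0$, $$F_Y^*(s)=\frac{F_\Delta^*(s)\,\bigl[F_X^*(s)-L^*(s)\bigr]}{1-L^*(s)}.$$
   Context: Laplace-Stieltjes transform: $G^*(s)=\int_{[0,\infty)} e^{-st}\,dG(t)$ for a nondecreasing right-continuous $G$ on $[0,\infty)$. All random variables are nonnegative, inter-request times are strictly positive, and the sequences of inter-request times and TTLs and the delay are mutually independent. Cache dynamics in one miss cycle: a request finding the object absent (a miss) occurs at time $0$; the object is admitted after the random delay $\Delta$, and by the assumption in the claim a request is taken to arrive at that very instant $\Delta$. From then on, successive requests are separated by i.i.d. inter-request times $X_0,X_1,\dots\sim X$. The TTL is regenerative: at the admission instant a TTL $T_0\sim T$ starts, and at each subsequent hit a fresh TTL $T_1,T_2,\dots\sim T$ starts. The $i$-th subsequent request (at the end of $X_i$, $i\ge 0$) is a hit if $X_i<T_i$; otherwise it is the miss that ends the cycle. The inter-miss time $Y$ is the length of this cycle, i.e. $Y=\Delta+\sum_{i=0}^{N}X_i$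 where $N=\min\{i\ge 0: X_i\ge T_i\}$ (with $Y=\infty$, $e^{-sY}=0$, if no such $i$ exists). *)

theory Defs
  imports "HOL-Probability.Probability"
begin

text \<open>
  Laplace-Stieltjes transform over \<open>[0,\<infinity>)\<close>.  The function \<open>G\<close> is extended by \<open>0\<close> to the negative
  reals, so that an atom of mass \<open>G 0\<close> at \<open>0\<close> contributes to the integral.  The Stieltjes measure is
  meaningful for nondecreasing right-continuous \<open>G\<close> with \<open>G 0 \<ge> 0\<close>.
\<close>

definition LST :: "(real \<Rightarrow> real) \<Rightarrow> real \<Rightarrow> real" where
  "LST G s = (LINT t:{0..}|interval_measure (\<lambda>t. if t < 0 then 0 else G t). exp (- (s * t)))"

definition L_fun :: "(real \<Rightarrow> real) \<Rightarrow> (real \<Rightarrow> real) \<Rightarrow> real \<Rightarrow> real" where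
  "L_fun F_T F_X t = (LINT x:{0..t}|interval_measure F_X. 1 - F_T x)"

text \<open>
  One miss cycle: the missed request occurs at time \<open>0\<close>, the object is admitted at time \<open>\<Delta>\<close> together
  with a request arrival, and from then on the \<open>i\<close>-th request ends the interval \<open>X i\<close>, during which
  the TTL \<open>T i\<close>, started at the previous request, is running.
\<close>

definition hit :: "(nat \<Rightarrow> 'a \<Rightarrow> real) \<Rightarrow> (nat \<Rightarrow> 'a \<Rightarrow> real) \<Rightarrow> nat \<Rightarrow> 'a \<Rightarrow> bool" where
  "hit X T i \<omega> \<longleftrightarrow> X i \<omega> < T i \<omega>"

definition inter_miss_time ::
  "('a \<Rightarrow> real) \<Rightarrow> (nat \<Rightarrow> 'a \<Rightarrow> real) \<Rightarrow> (nat \<Rightarrow> 'a \<Rightarrow> real) \<Rightarrow> 'a \<Rightarrow> ereal" where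
  "inter_miss_time \<Delta> X T \<omega> =
     (if \<exists>i. \<not> hit X T i \<omega>
      then ereal (\<Delta> \<omega> + (\<Sum>i\<le>(LEAST i. \<not> hit X T i \<omega>). X i \<omega>))
      else \<infinity>)"

text \<open>
  Possibly defective distribution function: mass at \<open>\<infinity>\<close> is not counted, so it contributes \<open>0\<close> to the
  Laplace-Stieltjes transform, in accordance with \<open>exp (- s * \<infinity>) = 0\<close>.
\<close>

definition ecdf :: "'a measure \<Rightarrow> ('a \<Rightarrow> ereal) \<Rightarrow> real \<Rightarrow> real" where
  "ecdf M Y t = measure M {\<omega> \<in> space M. Y \<omega> \<le> ereal t}"

end

theory Submission
  imports Defs
begin

text \<open>
  The integral of \<open>exp (- s Y)\<close> over the event that request \<open>n\<close> is the first miss factors by independence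
  as \<open>F\<^sub>\<Delta>\<^sup>* (s) p\<^sup>n q\<close>, where \<open>p = E[exp (- s X); X < T] = L\<^sup>* (s)\<close> and
  \<open>q = E[exp (- s X); X \<ge> T] = F\<^sub>X\<^sup>* (s) - L\<^sup>* (s)\<close>.  Since \<open>X > 0\<close> gives \<open>p \<le> F\<^sub>X\<^sup>* (s) < 1\<close>, summing the
  geometric series over \<open>n\<close> yields the formula.
\<close>

text \<open>A finite Borel measure on the line is determined by its cdf. Total mass 1 is not
  assumed, because the measures behind \<open>L_fun\<close> and \<open>ecdf\<close> may be
  defective.\<close>

lemma interval_measure_cdf:
  assumes "finite_borel_measure D"
  shows "interval_measure (cdf D) = D"
proof -
  interpret finite_borel_measure D by fact
  show ?thesis
    by (rule cdf_unique')
       (auto intro!: finite_borel_measure_interval_measure[where m = "measure D (space D)"]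
          cdf_interval_measure cdf_nondecreasing cdf_is_right_cont cdf_lim_at_bot cdf_lim_at_top assms)
qed

text \<open>Restricting \<open>M\<close> to \<open>A\<close> and pushing it forward along
  \<open>Z\<close> gives the Stieltjes measure of \<open>G\<close>, so the transform pulls back to
  an integral over \<open>A\<close>. The set \<open>A\<close> carries the defect: it is the whole
  space for the delay and for \<open>X i\<close>, the hit event for \<open>L_fun\<close>, and the
  event of a finite cycle for the inter-miss time.\<close>

lemma (in finite_measure) LST_eq_integral:
  fixes Z :: "'a \<Rightarrow> real"
  assumes Z [measurable]: "Z \<in> borel_measurable M" and A [measurable]: "A \<in> sets M"
    and nonneg: "AE \<omega> in M. \<omega> \<in> A \<longrightarrow> 0 \<le> Z \<omega>"
    and G: "\<And>t. 0 \<le> t \<Longrightarrow> G t = measure M {\<omega> \<in> A. Z \<omega> \<le> t}"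
  shows "LST G s = (LINT \<omega>:A|M. exp (- (s * Z \<omega>)))"
proof -
  define D where "D = distr (restrict_space M A) borel Z"
  have A_sub: "A \<subseteq> space M" using A by (rule sets.sets_into_space)
  have Z' [measurable]: "Z \<in> borel_measurable (restrict_space M A)"
    by (intro measurable_restrict_space1 Z)
  interpret R: finite_measure "restrict_space M A"
    by (intro finite_measure_restrict_space finite_measure_axioms) auto
  interpret D: finite_borel_measure D
    unfolding finite_borel_measure_def finite_borel_measure_axioms_def D_def
    by (auto intro!: R.finite_measure_distr)
  have cdf_D: "cdf D t = measure M {\<omega> \<in> A. Z \<omega> \<le> t}" for t
  proof -
    have "cdf D t = measure (restrict_space M A) {\<omega> \<in> A. Z \<omega> \<le> t}"
      unfolding cdf_def D_def using A_sub
      by (subst measure_distr) (auto simp: space_restrict_space Int_absorb2 intro!: arg_cong2[where f = measure])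
    also have "\<dots> = measure M {\<omega> \<in> A. Z \<omega> \<le> t}"
      using A_sub by (intro measure_restrict_space) auto
    finally show ?thesis .
  qed
  \<comment> \<open>This matches the value 0 that \<open>LST\<close> gives to its argument on the
    negative reals.\<close>
  have "cdf D t = 0" if "t < 0" for t
  proof -
    have "measure M {\<omega> \<in> A. Z \<omega> \<le> t} = measure M {}"
      using nonneg that A_sub by (intro finite_measure_eq_AE) auto
    then show ?thesis by (simp add: cdf_D)
  qed
  then have "(\<lambda>t. if t < 0 then 0 else G t) = cdf D"
    by (auto simp: fun_eq_iff cdf_D G)
  then have "LST G s = (LINT t:{0..}|D. exp (- (s * t)))"
    unfolding LST_def by (simp add: interval_measure_cdf D.finite_borel_measure_axioms)
  also have "\<dots> = (LINT \<omega>:A|M. indicator {0..} (Z \<omega>) * exp (- (s * Z \<omega>)))"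
    unfolding set_lebesgue_integral_def D_def using A_sub
    by (subst integral_distr) (auto simp: integral_restrict_space Int_absorb2)
  also have "\<dots> = (LINT \<omega>:A|M. exp (- (s * Z \<omega>)))"
    unfolding set_lebesgue_integral_def using nonneg
    by (intro integral_cong_AE) (auto simp: indicator_def)
  finally show ?thesis .
qed

section \<open>Independence and expectations of the factors of a cycle\<close>

context prob_space
begin

text \<open>Functions of disjoint blocks of an independent family are independent. Block 0 holds the
  delay and block \<open>Suc i\<close> the pair of \<open>X i\<close> and
  \<open>T i\<close>.\<close>

lemma indep_vars_blocks:
  fixes D :: "'a \<Rightarrow> real" and X T :: "nat \<Rightarrow> 'a \<Rightarrow> real"
    and f :: "real \<Rightarrow> real" and g :: "nat \<Rightarrow> real \<Rightarrow> real \<Rightarrow> real"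
  assumes ind: "indep_vars (\<lambda>_. borel) (case_sum (\<lambda>_::unit. D) (case_sum X T)) UNIV"
    and f [measurable]: "f \<in> borel_measurable borel"
    and g [measurable]: "\<And>i. case_prod (g i) \<in> borel_measurable (borel \<Otimes>\<^sub>M borel)"
  shows "indep_vars (\<lambda>_. borel) (case_nat (\<lambda>\<omega>. f (D \<omega>)) (\<lambda>i \<omega>. g i (X i \<omega>) (T i \<omega>))) UNIV"
proof -
  let ?V = "case_sum (\<lambda>_::unit. D) (case_sum X T)"
  let ?K = "case_nat {Inl ()} (\<lambda>i. {Inr (Inl i), Inr (Inr i)}) :: nat \<Rightarrow> (unit + nat + nat) set"
  let ?h = "case_nat (\<lambda>v. f (v (Inl ()))) (\<lambda>i v. g i (v (Inr (Inl i))) (v (Inr (Inr i))))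
    :: nat \<Rightarrow> (unit + nat + nat \<Rightarrow> real) \<Rightarrow> real"
  have disj: "disjoint_family ?K"
    by (auto simp: disjoint_family_on_def split: nat.splits)
  have h: "?h j \<in> borel_measurable (PiM (?K j) (\<lambda>_. borel))" for j
  proof (cases j)
    case (Suc i)
    have "(\<lambda>v. case_prod (g i) (v (Inr (Inl i)), v (Inr (Inr i)))) \<in> borel_measurable (PiM (?K j) (\<lambda>_. borel))"
      unfolding Suc by (intro measurable_compose[OF _ g] measurable_Pair measurable_component_singleton) auto
    then show ?thesis by (simp add: Suc)
  qed (auto intro!: measurable_compose[OF _ f] measurable_component_singleton)
  have "indep_vars (\<lambda>_. borel) (\<lambda>j \<omega>. ?h j (restrict (\<lambda>i. ?V i \<omega>) (?K j))) UNIV"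
    using h by (intro indep_vars_compose2[OF indep_vars_restrict[OF ind _ disj]]) auto
  also have "(\<lambda>j \<omega>. ?h j (restrict (\<lambda>i. ?V i \<omega>) (?K j))) =
      case_nat (\<lambda>\<omega>. f (D \<omega>)) (\<lambda>i \<omega>. g i (X i \<omega>) (T i \<omega>))"
    by (auto simp: fun_eq_iff split: nat.splits)
  finally show ?thesis .
qed

text \<open>The expectation of a product of independent blocks is the product of expectations.
  Letting \<open>g\<close> depend on \<open>i\<close> allows hit factors before the last request and
  a miss factor at it.\<close>

lemma expectation_blocks:
  fixes D :: "'a \<Rightarrow> real" and X T :: "nat \<Rightarrow> 'a \<Rightarrow> real"
    and f :: "real \<Rightarrow> real" and g :: "nat \<Rightarrow> real \<Rightarrow> real \<Rightarrow> real"
  assumes ind: "indep_vars (\<lambda>_. borel) (case_sum (\<lambda>_::unit. D) (case_sum X T)) UNIV"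
    and f: "f \<in> borel_measurable borel"
    and g: "\<And>i. case_prod (g i) \<in> borel_measurable (borel \<Otimes>\<^sub>M borel)"
    and int_f: "integrable M (\<lambda>\<omega>. f (D \<omega>))"
    and int_g: "\<And>i. integrable M (\<lambda>\<omega>. g i (X i \<omega>) (T i \<omega>))"
  shows "expectation (\<lambda>\<omega>. f (D \<omega>) * (\<Prod>i\<le>n. g i (X i \<omega>) (T i \<omega>))) =
    expectation (\<lambda>\<omega>. f (D \<omega>)) * (\<Prod>i\<le>n. expectation (\<lambda>\<omega>. g i (X i \<omega>) (T i \<omega>)))"
proof -
  let ?W = "case_nat (\<lambda>\<omega>. f (D \<omega>)) (\<lambda>i \<omega>. g i (X i \<omega>) (T i \<omega>))"
  have "expectation (\<lambda>\<omega>. \<Prod>j\<le>Suc n. ?W j \<omega>) = (\<Prod>j\<le>Suc n. expectation (?W j))"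
    using int_f int_g
    by (intro indep_vars_lebesgue_integral indep_vars_subset[OF indep_vars_blocks[OF ind f g]])
       (auto split: nat.splits)
  then show ?thesis
    by (simp add: prod.atMost_Suc_shift del: prod.atMost_Suc)
qed

text \<open>By Fubini on the product law of \<open>X\<close> and \<open>T\<close>: given
  \<open>X = x\<close>, the event \<open>X < T\<close> has probability \<open>1 - F_T x\<close>.
  Nonnegativity of \<open>X\<close> turns the range \<open>{0..t}\<close> of integration into the
  condition \<open>X \<le> t\<close>.\<close>

lemma L_fun_eq_prob:
  fixes X T :: "'a \<Rightarrow> real"
  assumes ind: "indep_var borel X borel T" and "AE \<omega> in M. 0 \<le> X \<omega>"
  shows "L_fun (cdf (distr M borel T)) (cdf (distr M borel X)) t = prob {\<omega> \<in> space M. X \<omega> < T \<omega> \<and> X \<omega> \<le> t}"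
proof -
  have [measurable]: "X \<in> borel_measurable M" "T \<in> borel_measurable M"
    using ind by (auto dest: indep_var_rv1 indep_var_rv2)
  interpret DX: real_distribution "distr M borel X" by simp
  interpret DT: real_distribution "distr M borel T" by simp
  \<comment> \<open>The complement of \<open>{..x}\<close> excludes \<open>x\<close>, in accordance
    with a tie \<open>X = T\<close> being a miss.\<close>
  have tail: "1 - cdf (distr M borel T) x = DT.prob {x<..}" for x
    using DT.prob_compl[of "{..x}"] by (simp add: cdf_def Compl_eq_Diff_UNIV[symmetric])
  let ?S = "{z \<in> space (borel \<Otimes>\<^sub>M borel). fst z < snd z \<and> fst z \<in> {0..t}} :: (real \<times> real) set"
  have S: "?S \<in> sets (borel \<Otimes>\<^sub>M borel)"
    by measurable
  have "ennreal (prob {\<omega> \<in> space M. X \<omega> < T \<omega> \<and> X \<omega> \<le> t}) =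
      emeasure M {\<omega> \<in> space M. X \<omega> < T \<omega> \<and> X \<omega> \<in> {0..t}}"
    unfolding emeasure_eq_measure[symmetric] using assms(2) by (intro emeasure_eq_AE) auto
  also have "\<dots> = emeasure (distr M (borel \<Otimes>\<^sub>M borel) (\<lambda>\<omega>. (X \<omega>, T \<omega>))) ?S"
    using S by (subst emeasure_distr) (auto intro!: arg_cong2[where f = emeasure] simp: space_pair_measure)
  also have "\<dots> = emeasure (distr M borel X \<Otimes>\<^sub>M distr M borel T) ?S"
    using ind by (simp add: indep_var_distribution_eq)
  also have "\<dots> = (\<integral>\<^sup>+x. emeasure (distr M borel T) (Pair x -` ?S) \<partial>distr M borel X)"
    using S by (intro DT.emeasure_pair_measure_alt) (simp cong: sets_pair_measure_cong)
  also have "\<dots> = (\<integral>\<^sup>+x. ennreal (indicator {0..t} x * DT.prob {x<..}) \<partial>distr M borel X)"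
    by (intro nn_integral_cong)
       (auto simp: indicator_def space_pair_measure DT.emeasure_eq_measure vimage_def greaterThan_def)
  also have "\<dots> = ennreal (\<integral>x. indicator {0..t} x * DT.prob {x<..} \<partial>distr M borel X)"
  proof (intro nn_integral_eq_integral DX.integrable_const_bound[where B = 1])
    \<comment> \<open>Measurability of the tail comes from monotonicity of the cdf.\<close>
    have "(\<lambda>x. 1 - cdf (distr M borel T) x) \<in> borel_measurable borel"
      by (intro borel_measurable_diff borel_measurable_const borel_measurable_mono monoI DT.cdf_nondecreasing)
    then show "(\<lambda>x. indicator {0..t} x * DT.prob {x<..}) \<in> borel_measurable (distr M borel X)"
      by (simp add: tail)
  qed (auto simp: indicator_def)
  finally show ?thesis
    unfolding L_fun_def set_lebesgue_integral_def tail
    by (subst interval_measure_cdf) (auto simp: DX.finite_borel_measure_M intro!: integral_nonneg_AE)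
qed

lemma integrable_exp_neg:
  fixes Z :: "'a \<Rightarrow> real"
  assumes [measurable]: "Z \<in> borel_measurable M" and nonneg: "AE \<omega> in M. 0 \<le> Z \<omega>" and "0 \<le> s"
  shows "integrable M (\<lambda>\<omega>. exp (- (s * Z \<omega>)))"
  using nonneg \<open>0 \<le> s\<close>
  by (intro integrable_const_bound[where B = 1]) (auto elim!: eventually_mono)

text \<open>The integrand is below 1 almost everywhere on a space of positive measure, so the
  inequality of integrals is strict. This keeps the ratio of the geometric series below 1.\<close>

lemma expectation_exp_less_1:
  fixes X :: "'a \<Rightarrow> real"
  assumes [measurable]: "X \<in> borel_measurable M" and pos: "AE \<omega> in M. 0 < X \<omega>" and "s > 0"
  shows "expectation (\<lambda>\<omega>. exp (- (s * X \<omega>))) < 1"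
proof -
  have "expectation (\<lambda>\<omega>. exp (- (s * X \<omega>))) < expectation (\<lambda>_. 1)"
  proof (rule integral_less_AE_space)
    show "AE \<omega> in M. exp (- (s * X \<omega>)) < 1"
      using pos by eventually_elim (simp add: \<open>s > 0\<close>)
    show "integrable M (\<lambda>\<omega>. exp (- (s * X \<omega>)))"
      using pos \<open>s > 0\<close> by (intro integrable_exp_neg) (auto elim!: eventually_mono)
  qed (auto simp: emeasure_space_1)
  then show ?thesis by (simp add: prob_space)
qed

end

theorem proposition1:
  fixes M :: "'a measure"
    and \<Delta> :: "'a \<Rightarrow> real" and X T :: "nat \<Rightarrow> 'a \<Rightarrow> real"
    and F_\<Delta> F_X F_T :: "real \<Rightarrow> real" and s :: real
  assumes "prob_space M"
    and "prob_space.indep_vars M (\<lambda>_. borel) (case_sum (\<lambda>_::unit. \<Delta>) (case_sum X T)) UNIV"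
    and "cdf (distr M borel \<Delta>) = F_\<Delta>"
    and "\<And>i. cdf (distr M borel (X i)) = F_X"
    and "\<And>i. cdf (distr M borel (T i)) = F_T"
    and "AE \<omega> in M. 0 \<le> \<Delta> \<omega>"
    and "\<And>i. AE \<omega> in M. 0 < X i \<omega>"
    and "\<And>i. AE \<omega> in M. 0 \<le> T i \<omega>"
    and "s > 0"
  shows "LST (ecdf M (inter_miss_time \<Delta> X T)) s =
           LST F_\<Delta> s * (LST F_X s - LST (L_fun F_T F_X) s) / (1 - LST (L_fun F_T F_X) s)"
proof -
  interpret prob_space M by fact
  note ind = assms(2) and \<Delta>_nonneg = assms(6) and X_pos = assms(7) and s = assms(9)
  have rv: "case_sum (\<lambda>_::unit. \<Delta>) (case_sum X T) k \<in> borel_measurable M" for k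
    using ind by (auto simp: indep_vars_def)
  have [measurable]: "\<Delta> \<in> borel_measurable M" "X i \<in> borel_measurable M" "T i \<in> borel_measurable M" for i
    using rv[of "Inl ()"] rv[of "Inr (Inl i)"] rv[of "Inr (Inr i)"] by auto
  \<comment> \<open>One null set must serve all \<open>i\<close>, since the number of summands in a
    cycle depends on \<open>\<omega>\<close>.\<close>
  have all_X_pos: "AE \<omega> in M. \<forall>i. 0 < X i \<omega>"
    using X_pos by (simp add: AE_all_countable)
  have indXT: "indep_var borel (X i) borel (T i)" for i
    using indep_var_compose[OF indep_var_restrict[OF ind, of "{Inr (Inl i)}" "{Inr (Inr i)}"],
        of "\<lambda>v. v (Inr (Inl i))" borel "\<lambda>v. v (Inr (Inr i))" borel]
    by (simp add: comp_def)
  have int_exp: "integrable M (\<lambda>\<omega>. exp (- (s * X i \<omega>)))" for i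
    using X_pos[of i] s by (intro integrable_exp_neg) (auto elim!: eventually_mono)
  have int_exp\<Delta>: "integrable M (\<lambda>\<omega>. exp (- (s * \<Delta> \<omega>)))"
    using \<Delta>_nonneg s by (intro integrable_exp_neg) auto

  \<comment> \<open>The given transforms as expectations\<close>
  define d where "d = LST F_\<Delta> s"
  define x where "x = LST F_X s"
  define p where "p = LST (L_fun F_T F_X) s"
  have d: "d = expectation (\<lambda>\<omega>. exp (- (s * \<Delta> \<omega>)))"
    unfolding d_def using \<Delta>_nonneg
    by (subst LST_eq_integral[where Z = \<Delta> and A = "space M"])
       (auto simp: assms(3)[symmetric] cdf_def measure_distr set_integral_space int_exp\<Delta>
         intro!: arg_cong2[where f = measure])
  \<comment> \<open>The left side is free of \<open>i\<close>: identical distribution enters here,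
    and likewise for \<open>p\<close> and \<open>x - p\<close> below.\<close>
  have x: "x = expectation (\<lambda>\<omega>. exp (- (s * X i \<omega>)))" for i
    unfolding x_def using X_pos[of i]
    by (subst LST_eq_integral[where Z = "X i" and A = "space M"])
       (auto simp: assms(4)[of i, symmetric] cdf_def measure_distr set_integral_space int_exp
         intro!: arg_cong2[where f = measure])
  have p: "p = expectation (\<lambda>\<omega>. if X i \<omega> < T i \<omega> then exp (- (s * X i \<omega>)) else 0)" for i
  proof -
    have "AE \<omega> in M. 0 \<le> X i \<omega>"
      using X_pos[of i] by eventually_elim simp
    then have "p = (LINT \<omega>:{\<omega> \<in> space M. X i \<omega> < T i \<omega>}|M. exp (- (s * X i \<omega>)))"
      unfolding p_def assms(4)[of i, symmetric] assms(5)[of i, symmetric]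
      by (intro LST_eq_integral) (auto simp: L_fun_eq_prob[OF indXT] intro!: arg_cong2[where f = measure])
    then show ?thesis
      unfolding set_lebesgue_integral_def
      by (auto simp: indicator_def intro!: Bochner_Integration.integral_cong)
  qed
  have int_hit: "integrable M (\<lambda>\<omega>. if X i \<omega> < T i \<omega> then exp (- (s * X i \<omega>)) else 0)"
    and int_miss: "integrable M (\<lambda>\<omega>. if X i \<omega> < T i \<omega> then 0 else exp (- (s * X i \<omega>)))" for i
    by (auto intro!: Bochner_Integration.integrable_bound[OF int_exp[of i]])
  \<comment> \<open>Removing the hit part of \<open>exp (- (s * X i \<omega>))\<close> leaves its
    miss part.\<close>
  have q: "x - p = expectation (\<lambda>\<omega>. if X i \<omega> < T i \<omega> then 0 else exp (- (s * X i \<omega>)))" for i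
    unfolding x[of i] p[of i] Bochner_Integration.integral_diff[OF int_exp int_hit, symmetric]
    by (intro Bochner_Integration.integral_cong) auto
  have p_nonneg: "0 \<le> p"
    unfolding p[of 0] by (intro integral_nonneg_AE) auto
  have "0 \<le> x - p"
    unfolding q[of 0] by (intro integral_nonneg_AE) auto
  moreover have "x < 1"
    unfolding x[of 0] using X_pos[of 0] s by (intro expectation_exp_less_1) auto
  ultimately have p_less: "p < 1" by simp

  \<comment> \<open>Decomposition by the index of the first miss\<close>
  define N where "N \<omega> = (LEAST i. \<not> hit X T i \<omega>)" for \<omega>
  \<comment> \<open>A real-valued stand-in for the inter-miss time. Without a miss, \<open>N\<close>
    is an unspecified natural number and \<open>Z\<close> is meaningless, so only its values on
    \<open>A\<close> matter.\<close>
  define Z where "Z \<omega> = \<Delta> \<omega> + (\<Sum>i\<le>N \<omega>. X i \<omega>)" for \<omega>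
  define F where "F n = {\<omega> \<in> space M. (\<forall>i<n. hit X T i \<omega>) \<and> \<not> hit X T n \<omega>}" for n
  define A where "A = (\<Union>n. F n)"
  have hit_meas [measurable]: "Measurable.pred M (hit X T i)" for i
    unfolding hit_def by measurable
  have F_meas [measurable]: "F n \<in> sets M" for n
    unfolding F_def by measurable
  have A_meas [measurable]: "A \<in> sets M"
    unfolding A_def by measurable
  have N_meas [measurable]: "N \<in> measurable M (count_space UNIV)"
    unfolding N_def by measurable
  have Z_meas [measurable]: "Z \<in> borel_measurable M"
  proof -
    \<comment> \<open>A random number of summands is handled by splitting over the countably many
      values of \<open>N\<close>.\<close>
    have "(\<lambda>\<omega>. (\<lambda>n \<omega>. \<Sum>i\<le>n. X i \<omega>) (N \<omega>) \<omega>) \<in> borel_measurable M"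
      by (rule measurable_compose_countable[OF _ N_meas]) measurable
    then show ?thesis
      unfolding Z_def by (intro borel_measurable_add) simp_all
  qed
  have N_F: "N \<omega> = n" if "\<omega> \<in> F n" for n \<omega>
    unfolding N_def using that by (intro Least_equality) (auto simp: F_def not_less[symmetric])
  have F_disj: "F m \<inter> F n = {}" if "m \<noteq> n" for m n
    using N_F that by blast
  have A_eq: "A = {\<omega> \<in> space M. \<exists>i. \<not> hit X T i \<omega>}"
  proof safe
    fix \<omega> i assume "\<omega> \<in> space M" "\<not> hit X T i \<omega>"
    then have "\<omega> \<in> F (N \<omega>)"
      unfolding F_def N_def
      using LeastI[of "\<lambda>i. \<not> hit X T i \<omega>" i] by (auto dest: not_less_Least)
    then show "\<omega> \<in> A" by (auto simp: A_def)
  qed (auto simp: A_def F_def)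
  have Z_nonneg: "AE \<omega> in M. 0 \<le> Z \<omega>"
    using \<Delta>_nonneg all_X_pos by eventually_elim (auto simp: Z_def less_imp_le intro!: add_nonneg_nonneg sum_nonneg)
  \<comment> \<open>Off \<open>A\<close> the inter-miss time is infinite, hence never at most a real
    \<open>t\<close>, and adds nothing to \<open>ecdf\<close>.\<close>
  have Y_eq: "LST (ecdf M (inter_miss_time \<Delta> X T)) s = (LINT \<omega>:A|M. exp (- (s * Z \<omega>)))"
  proof (rule LST_eq_integral)
    show "AE \<omega> in M. \<omega> \<in> A \<longrightarrow> 0 \<le> Z \<omega>"
      using Z_nonneg by eventually_elim simp
    show "ecdf M (inter_miss_time \<Delta> X T) t = prob {\<omega> \<in> A. Z \<omega> \<le> t}" for t
      unfolding ecdf_def inter_miss_time_def A_eq Z_def N_def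
      by (intro arg_cong2[where f = measure]) (auto split: if_splits)
  qed auto

  have first_miss: "(LINT \<omega>:F n|M. exp (- (s * Z \<omega>))) = d * (x - p) * p ^ n" for n
  proof -
    \<comment> \<open>The factors encode \<open>F n\<close> as well as the exponential: a hit is
      demanded at each \<open>i < n\<close> and a miss at \<open>n\<close>.\<close>
    define g where "g i = (if i < n then \<lambda>u v. if u < v then exp (- (s * u)) else 0
      else (\<lambda>u v. if u < v then 0 else exp (- (s * u))))" for i
    have g_meas: "case_prod (g i) \<in> borel_measurable (borel \<Otimes>\<^sub>M borel)" for i
      by (cases "i < n") (simp_all add: g_def)
    have "integrable M (\<lambda>\<omega>. g i (X i \<omega>) (T i \<omega>))" for i
      unfolding g_def using int_hit[of i] int_miss[of i] by (cases "i < n") simp_all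
    note prod_eq = expectation_blocks[OF ind _ g_meas int_exp\<Delta> this, of n]
    have g_prod: "(\<Prod>i\<le>n. g i (X i \<omega>) (T i \<omega>)) = (if \<omega> \<in> F n then exp (- (s * (\<Sum>i\<le>n. X i \<omega>))) else 0)"
      if "\<omega> \<in> space M" for \<omega>
    proof (cases "\<omega> \<in> F n")
      case True
      then have "g i (X i \<omega>) (T i \<omega>) = exp (- (s * X i \<omega>))" if "i \<le> n" for i
        using that by (cases "i = n") (auto simp: g_def F_def hit_def)
      then show ?thesis
        using True by (simp add: exp_sum sum_distrib_left sum_negf[symmetric])
    next
      case False
      then have "(\<exists>i<n. \<not> hit X T i \<omega>) \<or> hit X T n \<omega>"
        using that by (auto simp: F_def)
      \<comment> \<open>Outside \<open>F n\<close>, an earlier miss kills its hit factor or a hit at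
        \<open>n\<close> kills the miss factor.\<close>
      then have "\<exists>i\<in>{..n}. g i (X i \<omega>) (T i \<omega>) = 0"
      proof
        assume "\<exists>i<n. \<not> hit X T i \<omega>"
        then obtain i where "i < n" "\<not> hit X T i \<omega>" by blast
        then show ?thesis by (intro bexI[of _ i]) (simp_all add: g_def hit_def)
      next
        assume "hit X T n \<omega>"
        then show ?thesis by (intro bexI[of _ n]) (simp_all add: g_def hit_def)
      qed
      then have "(\<Prod>i\<le>n. g i (X i \<omega>) (T i \<omega>)) = 0"
        by (intro prod_zero) simp_all
      then show ?thesis
        using False by simp
    qed
    have "(LINT \<omega>:F n|M. exp (- (s * Z \<omega>))) =
        expectation (\<lambda>\<omega>. exp (- (s * \<Delta> \<omega>)) * (\<Prod>i\<le>n. g i (X i \<omega>) (T i \<omega>)))"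
      unfolding set_lebesgue_integral_def
      by (intro Bochner_Integration.integral_cong)
         (auto simp: g_prod Z_def N_F distrib_left exp_add[symmetric] indicator_def)
    also have "\<dots> = d * (\<Prod>i\<le>n. expectation (\<lambda>\<omega>. g i (X i \<omega>) (T i \<omega>)))"
      by (subst prod_eq) (simp_all add: d)
    \<comment> \<open>The \<open>n\<close> indices before the last give \<open>p\<close> each, and
      the last one gives \<open>x - p\<close>.\<close>
    also have "(\<Prod>i\<le>n. expectation (\<lambda>\<omega>. g i (X i \<omega>) (T i \<omega>))) = (\<Prod>i<n. p) * (x - p)"
      unfolding lessThan_Suc_atMost[symmetric] prod.lessThan_Suc
      by (intro arg_cong2[where f = times] prod.cong) (simp_all add: g_def p[symmetric] q[symmetric])
    finally show ?thesis by simp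
  qed
  have "set_integrable M A (\<lambda>\<omega>. exp (- (s * Z \<omega>)))"
    unfolding set_integrable_def using Z_nonneg s by (intro integrable_mult_indicator integrable_exp_neg) auto
  \<comment> \<open>Integrability on \<open>A\<close> permits summation over the disjoint sets
    \<open>F n\<close>.\<close>
  then have "(LINT \<omega>:A|M. exp (- (s * Z \<omega>))) = (\<Sum>n. d * (x - p) * p ^ n)"
    unfolding A_def by (subst lebesgue_integral_countable_add) (simp_all add: F_disj first_miss)
  also have "\<dots> = d * (x - p) / (1 - p)"
    using p_nonneg p_less by (simp add: suminf_mult suminf_geometric)
  finally show ?thesis
    unfolding Y_eq d_def x_def p_def .
qed

end
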